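(* For all integers $k\le r$ with $k-1>1$ and every $n\ge 1$ there exists an ordered $r$-graph $H^r_n(k)$ with $rn$ vertices and at least one edge such that the following holds for every real $\alpha$ with $1\le\alpha<k-1\le r-1$: writing $e(H^r_n(k))=d\,n^{\alpha}$ (so $d>0$ may depend on $n$) and $a=\min\{1,k-1-\alpha\}>0$, $$e(H')=O\!\left(\frac{d\,m^{\alpha}}{n^{a}}\right)$$ for every interval $k$-partite subgraph $H'\subset H^r_n(k)$ with parts of size $m$.
   Context: An $r$-graph is a finite hypergraph all of whose edges have size $r$; $e(H)$ is the number of edges of $H$. An ordered $r$-graph is an $r$-graph with a linear ordering of its vertex set $V$. An interval in $V$ is a set of consecutive elements in the ordering; $A<B$ means $a<b$ for all $a\in A$, $b\in B$. An ordered $r$-graph $H$ is interval $k$-partite if for some $\ell\ge k$ there are intervals $I_1<I_2<\cdots<I_\ell$ (the parts) of the vertex set such that every edge of $H$ is contained in $I_1\cup\dots\cup I_\ell$ and has nonempty intersection with $I_j$ for each $1\le j\le \ell$. The implicit constant in $O(\cdot)$ depends only on $r,k,\alpha$, and not on $n$, $m$ or $H'$. *)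

theory Defs
  imports Complex_Main
begin

datatype 'a hypergraph = Hypergraph (verts: "'a set") (edges: "'a set set")

text \<open>The linear ordering of the vertex set is the one inherited from the vertex type.\<close>

definition ordered_rgraph :: "nat \<Rightarrow> 'a::linorder hypergraph \<Rightarrow> bool" where
  "ordered_rgraph r H \<longleftrightarrow>
     finite (verts H) \<and> (\<forall>e\<in>edges H. e \<subseteq> verts H \<and> card e = r)"

definition num_edges :: "'a hypergraph \<Rightarrow> nat" where
  "num_edges H = card (edges H)"

definition subgraph :: "'a hypergraph \<Rightarrow> 'a hypergraph \<Rightarrow> bool" where
  "subgraph H' H \<longleftrightarrow> verts H' \<subseteq> verts H \<and> edges H' \<subseteq> edges H"

definition interval_in :: "'a::linorder set \<Rightarrow> 'a set \<Rightarrow> bool" where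
  "interval_in V I \<longleftrightarrow>
     I \<subseteq> V \<and> (\<forall>x\<in>I. \<forall>y\<in>I. \<forall>z\<in>V. x \<le> z \<and> z \<le> y \<longrightarrow> z \<in> I)"

definition set_less :: "'a::linorder set \<Rightarrow> 'a set \<Rightarrow> bool" where
  "set_less A B \<longleftrightarrow> (\<forall>a\<in>A. \<forall>b\<in>B. a < b)"

text \<open>
  The list \<open>Is\<close> of parts may have any length \<open>\<ell> \<ge> k\<close>. The parts are intervals of the vertex
  set of \<open>H\<close> itself, which matters when \<open>H\<close> is a non-spanning subgraph of a larger hypergraph.
\<close>

definition interval_partite_with ::
    "nat \<Rightarrow> 'a::linorder hypergraph \<Rightarrow> 'a set list \<Rightarrow> bool" where
  "interval_partite_with k H Is \<longleftrightarrow>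
     k \<le> length Is \<and>
     (\<forall>I\<in>set Is. interval_in (verts H) I) \<and>
     sorted_wrt set_less Is \<and>
     (\<forall>e\<in>edges H. e \<subseteq> \<Union>(set Is) \<and> (\<forall>I\<in>set Is. e \<inter> I \<noteq> {}))"

definition interval_partite_size ::
    "nat \<Rightarrow> nat \<Rightarrow> 'a::linorder hypergraph \<Rightarrow> bool" where
  "interval_partite_size k m H \<longleftrightarrow>
     (\<exists>Is. interval_partite_with k H Is \<and> (\<forall>I\<in>set Is. card I = m))"

end

theory Submission
  imports Defs "HOL-Library.Disjoint_Sets"
begin

text \<open>
  Put \<open>q = k - 2\<close> and \<open>s = r - q\<close>. An edge of \<open>H n\<close> is a run of \<open>s\<close> consecutive vertices together
  with \<open>q\<close> further vertices, each taken freely from its own interval of length \<open>n\<close>; there are \<open>n\<close>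
  choices for each of these \<open>q + 1\<close> pieces. If such an edge meets \<open>q + 2\<close> or more parts
  \<open>I\<^sub>1 < I\<^sub>2 < \<dots>\<close>, then the run meets two of them, so it contains the last element of the earlier one,
  which leaves only boundedly many positions for the run. Hence an interval \<open>k\<close>-partite subgraph with
  parts of size \<open>m\<close> has \<open>O(m\<^bsup>q\<^esup>)\<close> of the \<open>n\<^bsup>q+1\<^esup>\<close> edges, which implies the bound for every \<open>\<alpha>\<close>
  because \<open>1 \<le> m \<le> r n\<close>.
\<close>

definition transversals :: "'i set \<Rightarrow> ('i \<Rightarrow> 'a set) \<Rightarrow> 'a set set" where
  "transversals I A = (\<lambda>f. f ` I) ` Pi\<^sub>E I A"

lemma inj_on_image_PiE:
  assumes "disjoint_family_on A I"
  shows "inj_on (\<lambda>f. f ` I) (Pi\<^sub>E I A)"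
proof (rule inj_onI)
  fix f g assume f: "f \<in> Pi\<^sub>E I A" and g: "g \<in> Pi\<^sub>E I A" and image_eq: "f ` I = g ` I"
  show "f = g"
  proof (rule PiE_ext[OF f g])
    fix i assume "i \<in> I"
    with image_eq obtain j where j: "j \<in> I" "f i = g j" by blast
    with f g \<open>i \<in> I\<close> have "f i \<in> A i" "f i \<in> A j" by (auto simp: PiE_iff)
    with disjoint_family_onD[OF assms \<open>i \<in> I\<close> j(1)] have "i = j" by blast
    with j(2) show "f i = g i" by simp
  qed
qed

lemma card_transversals:
  assumes "finite I" "disjoint_family_on A I"
  shows "card (transversals I A) = (\<Prod>i\<in>I. card (A i))"
  using assms by (simp add: transversals_def card_image inj_on_image_PiE card_PiE)

lemma finite_transversal:
  assumes "finite I" "T \<in> transversals I A"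
  shows "finite T"
  using assms by (auto simp: transversals_def)

lemma Union_transversals_subset: "\<Union>(transversals I A) \<subseteq> (\<Union>i\<in>I. A i)"
  by (auto simp: transversals_def)

lemma card_transversal:
  assumes "disjoint_family_on A I" "T \<in> transversals I A"
  shows "card T = card I"
proof -
  obtain f where f: "f \<in> Pi\<^sub>E I A" "T = f ` I" using assms(2) by (auto simp: transversals_def)
  have "i = j" if "i \<in> I" "j \<in> I" "f i = f j" for i j
    using disjoint_family_onD[OF assms(1) that(1,2)] PiE_mem[OF f(1) that(1)]
      PiE_mem[OF f(1) that(2)] that(3) by auto
  then show ?thesis unfolding f(2) by (intro card_image inj_onI)
qed

lemma inj_on_Un_disjoint:
  assumes "\<Union>\<A> \<inter> \<Union>\<B> = {}"
  shows "inj_on (\<lambda>(A, B). A \<union> B) (\<A> \<times> \<B>)"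
proof (rule inj_onI, clarify)
  have recover: "(A \<union> B) \<inter> \<Union>\<A> = A" "(A \<union> B) \<inter> \<Union>\<B> = B" if "A \<in> \<A>" "B \<in> \<B>" for A B
    using assms that by blast+
  fix A B A' B' assume "A \<in> \<A>" "B \<in> \<B>" "A' \<in> \<A>" "B' \<in> \<B>" "A \<union> B = A' \<union> B'"
  then show "A = A' \<and> B = B'" using recover by metis
qed

definition segment :: "nat \<Rightarrow> nat \<Rightarrow> nat set" where
  "segment n i = {i * n..<Suc i * n}"

definition runs :: "nat \<Rightarrow> nat \<Rightarrow> nat set set" where
  "runs s n = (\<lambda>b. {b..<b + s}) ` {..<n}"

definition run_hypergraph :: "nat \<Rightarrow> nat \<Rightarrow> nat \<Rightarrow> nat hypergraph" where
  "run_hypergraph s q n =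
     Hypergraph {..<(s + q) * n}
       ((\<lambda>(B, T). B \<union> T) ` (runs s n \<times> transversals {s..<s + q} (segment n)))"

lemma card_runs:
  assumes "0 < s"
  shows "card (runs s n) = n"
proof -
  have "inj_on (\<lambda>b. {b..<b + s}) {..<n}"
    using assms by (intro inj_onI) (simp add: atLeastLessThan_eq_iff)
  then show ?thesis by (simp add: runs_def card_image)
qed

lemma Union_runs_subset: "\<Union>(runs s n) \<subseteq> {..<s * n}"
proof (clarsimp simp: runs_def)
  fix x b :: nat assume x: "b \<le> x" "x < b + s" and "b < n"
  then obtain n' s' where "n = Suc n'" "s = Suc s'" by (cases n; cases s) auto
  with x \<open>b < n\<close> show "x < s * n" by auto
qed

lemma disjoint_family_on_segment: "disjoint_family_on (segment n) I"
proof -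
  have "x div n = i" if "x \<in> segment n i" for x i
    using that by (intro div_nat_eqI) (auto simp: segment_def mult.commute)
  then show ?thesis by (auto simp: disjoint_family_on_def)
qed

lemma UN_segment_subset: "(\<Union>i\<in>{a..<b}. segment n i) \<subseteq> {a * n..<b * n}"
proof (clarsimp simp: segment_def)
  fix x i assume i: "a \<le> i" "i < b" and x: "i * n \<le> x" "x < n + i * n"
  have "a * n \<le> i * n" using i(1) by (rule mult_le_mono1)
  moreover have "Suc i * n \<le> b * n" using i(2) by (intro mult_le_mono1) simp
  ultimately show "a * n \<le> x \<and> x < b * n" using x by (simp only: mult_Suc) linarith
qed

lemma Union_transversals_segment_subset:
  "\<Union>(transversals {a..<b} (segment n)) \<subseteq> {a * n..<b * n}"
  using Union_transversals_subset UN_segment_subset by (rule subset_trans)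

lemma Union_runs_disjoint_transversals:
  "\<Union>(runs s n) \<inter> \<Union>(transversals {s..<s + q} (segment n)) = {}"
proof -
  have "{..<s * n} \<inter> {s * n..<(s + q) * n} = {}" by auto
  then show ?thesis
    using Union_runs_subset Union_transversals_segment_subset by blast
qed

lemma num_edges_run_hypergraph:
  assumes "0 < s"
  shows "num_edges (run_hypergraph s q n) = n ^ Suc q"
proof -
  have "num_edges (run_hypergraph s q n) =
      card (runs s n) * card (transversals {s..<s + q} (segment n))"
    by (simp add: num_edges_def run_hypergraph_def card_cartesian_product
        card_image[OF inj_on_Un_disjoint[OF Union_runs_disjoint_transversals]])
  also have "\<dots> = n ^ Suc q"
    using assms
    by (simp add: card_runs card_transversals disjoint_family_on_segment) (simp add: segment_def)
  finally show ?thesis .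
qed

lemma edge_run_hypergraphE:
  assumes "e \<in> edges (run_hypergraph s q n)"
  obtains b T where "e = {b..<b + s} \<union> T" "{b..<b + s} \<subseteq> {..<s * n}"
    "finite T" "card T = q" "T \<subseteq> {s * n..<(s + q) * n}"
proof -
  obtain b T where e: "e = {b..<b + s} \<union> T" and run: "{b..<b + s} \<in> runs s n"
    and T: "T \<in> transversals {s..<s + q} (segment n)"
    using assms by (auto simp: run_hypergraph_def runs_def)
  have "{b..<b + s} \<subseteq> {..<s * n}" using run Union_runs_subset by blast
  moreover have "T \<subseteq> {s * n..<(s + q) * n}"
    using T Union_transversals_segment_subset by blast
  moreover have "finite T" "card T = q"
    using finite_transversal[OF _ T] card_transversal[OF disjoint_family_on_segment T] by simp_all
  ultimately show thesis using that e by blast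
qed

lemma ordered_rgraph_run_hypergraph: "ordered_rgraph (s + q) (run_hypergraph s q n)"
  unfolding ordered_rgraph_def
proof (intro conjI ballI)
  show "finite (verts (run_hypergraph s q n))" by (simp add: run_hypergraph_def)
next
  fix e assume "e \<in> edges (run_hypergraph s q n)"
  then obtain b T where e: "e = {b..<b + s} \<union> T" and run: "{b..<b + s} \<subseteq> {..<s * n}"
    and T: "finite T" "card T = q" "T \<subseteq> {s * n..<(s + q) * n}"
    by (rule edge_run_hypergraphE)
  have "{..<s * n} \<union> {s * n..<(s + q) * n} = {..<(s + q) * n}"
    by (intro ivl_disj_un) simp
  with e run T(3) show "e \<subseteq> verts (run_hypergraph s q n)"
    by (simp add: run_hypergraph_def) blast
  have "{b..<b + s} \<inter> T = {}" using run T(3) by fastforce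
  with e T(1,2) show "card e = s + q" by (simp add: card_Un_disjoint)
qed

lemma card_meeting_disjoint_family_le:
  assumes "disjoint_family_on A I" "finite T"
  shows "card {i \<in> I. A i \<inter> T \<noteq> {}} \<le> card T"
proof -
  let ?M = "{i \<in> I. A i \<inter> T \<noteq> {}}"
  obtain f where f: "\<forall>i\<in>?M. f i \<in> A i \<inter> T"
    using bchoice[of ?M "\<lambda>i x. x \<in> A i \<inter> T"] by blast
  have "inj_on f ?M"
  proof (rule inj_onI)
    fix i j assume i: "i \<in> ?M" and j: "j \<in> ?M" and "f i = f j"
    then have "f i \<in> A i \<inter> A j" using f by fastforce
    with i j show "i = j" using disjoint_family_onD[OF assms(1)] by blast
  qed
  moreover have "f ` ?M \<subseteq> T" using f by blast
  ultimately show ?thesis using assms(2) by (rule card_inj_on_le)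
qed

lemma disjoint_family_on_nth_if_set_less:
  assumes "sorted_wrt set_less Is"
  shows "disjoint_family_on ((!) Is) {..<length Is}"
  unfolding disjoint_family_on_def
proof (intro ballI impI)
  have less: "set_less (Is ! i) (Is ! j)" if "i < j" "j < length Is" for i j
    using assms that by (simp add: sorted_wrt_iff_nth_less)
  fix i j assume "i \<in> {..<length Is}" "j \<in> {..<length Is}" "i \<noteq> j"
  then show "Is ! i \<inter> Is ! j = {}"
    using less[of i j] less[of j i]
    by (cases i j rule: linorder_cases) (fastforce simp: set_less_def)+
qed

lemma interval_partite_with_length_le:
  assumes "ordered_rgraph r H" "interval_partite_with k H Is" "edges H \<noteq> {}"
  shows "length Is \<le> r"
proof -
  obtain e where "e \<in> edges H" using assms(3) by blast
  then have e: "finite e" "card e = r" "\<forall>I\<in>set Is. I \<inter> e \<noteq> {}"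
    using assms(1,2)
    by (auto simp: ordered_rgraph_def interval_partite_with_def Int_commute intro: finite_subset)
  then have "{i \<in> {..<length Is}. Is ! i \<inter> e \<noteq> {}} = {..<length Is}" by auto
  then show ?thesis
    using card_meeting_disjoint_family_le[of "(!) Is" "{..<length Is}" e] assms(2) e(1,2)
    by (simp add: disjoint_family_on_nth_if_set_less interval_partite_with_def)
qed

lemma interval_partite_with_finite_part:
  assumes "finite (verts H)" "interval_partite_with k H Is" "I \<in> set Is"
  shows "finite I"
  using assms
  by (auto simp: interval_partite_with_def interval_in_def intro: finite_subset)

lemma interval_partite_size_bounds:
  assumes "finite (verts H)" "interval_partite_size k m H" "0 < k" "edges H \<noteq> {}"
  shows "1 \<le> m" "m \<le> card (verts H)"
proof -
  obtain Is where part: "interval_partite_with k H Is" and size: "\<forall>I\<in>set Is. card I = m"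
    using assms(2) by (auto simp: interval_partite_size_def)
  then obtain I where I: "I \<in> set Is"
    using assms(3) by (cases Is) (auto simp: interval_partite_with_def)
  have "I \<subseteq> verts H" "I \<noteq> {}"
    using part I assms(4) by (auto simp: interval_partite_with_def interval_in_def)
  then have "1 \<le> card I" "card I \<le> card (verts H)"
    using assms(1) interval_partite_with_finite_part[OF assms(1) part I]
    by (simp_all add: card_mono Suc_le_eq card_gt_0_iff)
  with size I show "1 \<le> m" "m \<le> card (verts H)" by simp_all
qed

lemma Max_in_atLeastLessThan_if_meets_greater:
  assumes "finite I" "set_less I J" "{b..<c} \<inter> I \<noteq> {}" "{b..<c} \<inter> J \<noteq> {}"
  shows "Max I \<in> {b..<c}"
proof -
  obtain x y where x: "x \<in> I" "b \<le> x" and y: "y \<in> J" "y < c" using assms(3,4) by auto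
  have "x \<le> Max I" "Max I \<in> I" using assms(1) x(1) by (auto intro: Max_in)
  with assms(2) x(2) y show ?thesis by (force simp: set_less_def)
qed

lemma atLeastLessThan_contains_Max_of_part:
  fixes Is :: "'a::linorder set list"
  assumes "sorted_wrt set_less Is" "\<And>I. I \<in> set Is \<Longrightarrow> finite I"
    and "finite T" "card T + 2 \<le> length Is"
    and meets: "\<And>I. I \<in> set Is \<Longrightarrow> ({b..<c} \<union> T) \<inter> I \<noteq> {}"
  obtains I where "I \<in> set Is" "Max I \<in> {b..<c}"
proof -
  define M where "M = {i \<in> {..<length Is}. Is ! i \<inter> T \<noteq> {}}"
  have "card M \<le> card T"
    unfolding M_def
    using assms(1,3) by (intro card_meeting_disjoint_family_le disjoint_family_on_nth_if_set_less)
  moreover have "card ({..<length Is} - M) = length Is - card M"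
    by (subst card_Diff_subset) (auto simp: M_def)
  ultimately have "\<not> card ({..<length Is} - M) \<le> Suc 0" using assms(4) by linarith
  then obtain i j where ij: "i \<in> {..<length Is} - M" "j \<in> {..<length Is} - M" "i < j"
    by (subst (asm) card_le_Suc0_iff_eq) (auto elim: linorder_neqE_nat)
  have "{b..<c} \<inter> Is ! l \<noteq> {}" if "l \<in> {..<length Is} - M" for l
    using meets[of "Is ! l"] that by (auto simp: M_def)
  with ij assms(1,2) have "Max (Is ! i) \<in> {b..<c}"
    by (intro Max_in_atLeastLessThan_if_meets_greater[of _ "Is ! j"])
      (auto simp: sorted_wrt_iff_nth_less)
  with ij(1) show thesis using that[of "Is ! i"] by simp
qed

lemma card_UN_set_le:
  assumes "\<And>x. x \<in> set xs \<Longrightarrow> card (f x) \<le> m"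
  shows "card (\<Union>x\<in>set xs. f x) \<le> length xs * m"
proof -
  have "card (\<Union>x\<in>set xs. f x) \<le> (\<Sum>x\<in>set xs. card (f x))" by (simp add: card_UN_le)
  also have "\<dots> \<le> card (set xs) * m"
    using assms sum_bounded_above[of "set xs" "\<lambda>x. card (f x)" m] by simp
  also have "\<dots> \<le> length xs * m" by (simp add: card_length)
  finally show ?thesis .
qed

lemma card_subsets_le_power:
  assumes "finite A"
  shows "card {T. T \<subseteq> A \<and> card T = q} \<le> card A ^ q"
  using assms by (cases "q \<le> card A") (simp_all add: n_subsets binomial_le_pow binomial_eq_0)

lemma num_edges_interval_partite_runs_le:
  fixes H :: "nat hypergraph"
  assumes fin: "finite (verts H)"
    and part: "interval_partite_with (q + 2) H Is" and size: "\<And>I. I \<in> set Is \<Longrightarrow> card I = m"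
    and shape: "\<And>e. e \<in> edges H \<Longrightarrow> \<exists>b T. e = {b..<b + s} \<union> T \<and> finite T \<and> card T = q"
  shows "num_edges H \<le> length Is * s * (length Is * m) ^ q"
proof -
  define starts where "starts = (\<Union>I\<in>set Is. {Suc (Max I) - s..<Suc (Max I)})"
  define remainders where "remainders = {T. T \<subseteq> \<Union>(set Is) \<and> card T = q}"
  note finite_part = interval_partite_with_finite_part[OF fin part]
  have "edges H \<subseteq> (\<lambda>(b, T). {b..<b + s} \<union> T) ` (starts \<times> remainders)"
  proof
    fix e assume e: "e \<in> edges H"
    then obtain b T where bT: "e = {b..<b + s} \<union> T" "finite T" "card T = q"
      using shape by blast
    obtain I where "I \<in> set Is" "Max I \<in> {b..<b + s}"
    proof (rule atLeastLessThan_contains_Max_of_part[OF _ finite_part bT(2)])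
      show "sorted_wrt set_less Is" "card T + 2 \<le> length Is"
        using part bT(3) by (simp_all add: interval_partite_with_def)
      show "({b..<b + s} \<union> T) \<inter> I \<noteq> {}" if "I \<in> set Is" for I
        using part e bT(1) that by (auto simp: interval_partite_with_def)
    qed
    then have "b \<in> starts" by (force simp: starts_def)
    moreover have "T \<in> remainders"
      using part e bT by (auto simp: remainders_def interval_partite_with_def)
    ultimately show "e \<in> (\<lambda>(b, T). {b..<b + s} \<union> T) ` (starts \<times> remainders)"
      using bT(1) by force
  qed
  moreover have "finite (starts \<times> remainders)"
    using finite_part by (simp add: starts_def remainders_def)
  ultimately have "num_edges H \<le> card (starts \<times> remainders)"
    unfolding num_edges_def by (rule surj_card_le[rotated])
  also have "\<dots> = card starts * card remainders" by (rule card_cartesian_product)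
  also have "\<dots> \<le> (length Is * s) * (length Is * m) ^ q"
  proof (rule mult_le_mono)
    show "card starts \<le> length Is * s" unfolding starts_def by (rule card_UN_set_le) simp
    have "card remainders \<le> card (\<Union>(set Is)) ^ q"
      using finite_part by (simp add: remainders_def card_subsets_le_power)
    also have "\<dots> \<le> (length Is * m) ^ q"
      using card_UN_set_le[of Is id m] size by (simp add: power_mono)
    finally show "card remainders \<le> (length Is * m) ^ q" .
  qed
  finally show ?thesis .
qed

lemma powr_le_powr_max:
  fixes x y c p \<alpha> :: real
  assumes "1 \<le> x" "x \<le> c * y" "1 \<le> c" "0 \<le> y" "0 \<le> p" "0 \<le> \<alpha>"
  shows "x powr p \<le> c powr p * (y powr max 0 (p - \<alpha>) * x powr \<alpha>)"
proof -
  have "x powr (p - \<alpha>) \<le> x powr max 0 (p - \<alpha>)" using assms(1) by (intro powr_mono) auto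
  also have "\<dots> \<le> (c * y) powr max 0 (p - \<alpha>)" using assms(1,2) by (intro powr_mono2) auto
  also have "\<dots> = c powr max 0 (p - \<alpha>) * y powr max 0 (p - \<alpha>)"
    using assms(3,4) by (simp add: powr_mult)
  also have "\<dots> \<le> c powr p * y powr max 0 (p - \<alpha>)"
    using assms(3,5,6) by (intro mult_right_mono powr_mono) auto
  finally have "x powr (p - \<alpha>) * x powr \<alpha> \<le> c powr p * y powr max 0 (p - \<alpha>) * x powr \<alpha>"
    by (rule mult_right_mono) simp
  then show ?thesis by (simp add: mult.assoc flip: powr_add)
qed

lemma powr_density_divide:
  fixes y d p \<alpha> :: real
  assumes "0 < y" "y powr (p + 1) = d * y powr \<alpha>"
  shows "d / y powr min 1 (p + 1 - \<alpha>) = y powr max 0 (p - \<alpha>)"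
proof -
  have "d = y powr (p + 1 - \<alpha>)" using assms by (simp add: powr_diff)
  moreover have "p + 1 - \<alpha> - min 1 (p + 1 - \<alpha>) = max 0 (p - \<alpha>)" by simp
  ultimately show ?thesis by (simp flip: powr_diff)
qed

lemma powr_le_density_bound:
  fixes x y c d p \<alpha> :: real
  assumes "1 \<le> x" "x \<le> c * y" "1 \<le> c" "0 < y" "0 \<le> p" "0 \<le> \<alpha>"
    and density: "y powr (p + 1) = d * y powr \<alpha>"
  shows "x powr p \<le> c powr p * (d * x powr \<alpha> / y powr min 1 (p + 1 - \<alpha>))"
proof -
  have "d * x powr \<alpha> / y powr min 1 (p + 1 - \<alpha>) = y powr max 0 (p - \<alpha>) * x powr \<alpha>"
    using powr_density_divide[OF \<open>0 < y\<close> density] by (simp flip: times_divide_eq_left)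
  then show ?thesis using powr_le_powr_max assms by simp
qed

lemma num_edges_interval_partite_run_subgraph_le:
  assumes "ordered_rgraph (s + q) H'" "subgraph H' (run_hypergraph s q n)"
    and "interval_partite_size (q + 2) m H'"
  shows "num_edges H' \<le> (s + q) * s * ((s + q) * m) ^ q"
proof (cases "edges H' = {}")
  case True
  then show ?thesis by (simp add: num_edges_def)
next
  case False
  obtain Is where part: "interval_partite_with (q + 2) H' Is"
    and size: "\<And>I. I \<in> set Is \<Longrightarrow> card I = m"
    using assms(3) by (auto simp: interval_partite_size_def)
  have "num_edges H' \<le> length Is * s * (length Is * m) ^ q"
  proof (rule num_edges_interval_partite_runs_le[OF _ part size])
    show "finite (verts H')" using assms(1) by (simp add: ordered_rgraph_def)
    show "\<exists>b T. e = {b..<b + s} \<union> T \<and> finite T \<and> card T = q" if "e \<in> edges H'" for e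
      using that assms(2) by (metis edge_run_hypergraphE subgraph_def subsetD)
  qed
  also have "\<dots> \<le> (s + q) * s * ((s + q) * m) ^ q"
    using interval_partite_with_length_le[OF assms(1) part False]
    by (intro mult_le_mono power_mono) auto
  finally show ?thesis .
qed

lemma num_edges_interval_partite_run_subgraph_density_le:
  fixes d \<alpha> :: real
  assumes "0 < s" "1 \<le> n" "0 \<le> \<alpha>"
    and density: "real (num_edges (run_hypergraph s q n)) = d * real n powr \<alpha>"
    and H': "ordered_rgraph (s + q) H'" "subgraph H' (run_hypergraph s q n)"
      "interval_partite_size (q + 2) m H'"
  shows "real (num_edges H') \<le> real ((s + q) * s * (s + q) ^ (2 * q)) *
    (d * real m powr \<alpha> / real n powr min 1 (real q + 1 - \<alpha>))"
proof (cases "edges H' = {}")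
  case True
  have "0 \<le> d * real n powr \<alpha>" unfolding density[symmetric] by simp
  with \<open>1 \<le> n\<close> have "0 \<le> d" by (simp add: zero_le_mult_iff)
  with True show ?thesis by (simp add: num_edges_def)
next
  case False
  define r where "r = s + q"
  have m_bounds: "1 \<le> m" "m \<le> card (verts H')"
    using interval_partite_size_bounds[OF _ H'(3) _ False] H'(1)
    by (simp_all add: ordered_rgraph_def)
  have "card (verts H') \<le> card {..<r * n}"
    using H'(2) by (intro card_mono) (auto simp: subgraph_def run_hypergraph_def r_def)
  with m_bounds(2) have "real m \<le> real r * real n" by (simp flip: of_nat_mult)
  moreover have "real n powr (real q + 1) = d * real n powr \<alpha>"
    using density \<open>0 < s\<close> \<open>1 \<le> n\<close>
    by (simp add: num_edges_run_hypergraph powr_add powr_realpow mult.commute)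
  ultimately have m_powr_le: "real m powr real q \<le>
      real r powr real q * (d * real m powr \<alpha> / real n powr min 1 (real q + 1 - \<alpha>))"
    using assms(1-3) m_bounds(1) by (intro powr_le_density_bound) (simp_all add: r_def)
  have "real (num_edges H') \<le> real (r * s * r ^ q) * real m powr real q"
    using num_edges_interval_partite_run_subgraph_le[OF H'] m_bounds(1)
    by (simp add: r_def powr_realpow power_mult_distrib mult.assoc
        flip: of_nat_mult of_nat_power of_nat_add)
  also have "\<dots> \<le> real (r * s * r ^ q) *
      (real r powr real q * (d * real m powr \<alpha> / real n powr min 1 (real q + 1 - \<alpha>)))"
    using m_powr_le by (rule mult_left_mono) simp
  finally show ?thesis
    using \<open>0 < s\<close> by (simp add: r_def powr_realpow mult_2 power_add mult.assoc)
qed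

theorem mainTheorem9:
  fixes r k :: nat
  assumes "k \<le> r" and "1 < k - 1"
  shows "\<exists>H :: nat \<Rightarrow> nat hypergraph.
    (\<forall>n\<ge>1. ordered_rgraph r (H n) \<and> card (verts (H n)) = r * n \<and> 1 \<le> num_edges (H n)) \<and>
    (\<forall>\<alpha>::real. 1 \<le> \<alpha> \<and> \<alpha> < real k - 1 \<longrightarrow>
      (\<exists>C>0. \<forall>n\<ge>1. \<forall>d a :: real. \<forall>m H'.
        real (num_edges (H n)) = d * real n powr \<alpha> \<longrightarrow>
        a = min 1 (real k - 1 - \<alpha>) \<longrightarrow>
        ordered_rgraph r H' \<longrightarrow> subgraph H' (H n) \<longrightarrow> interval_partite_size k m H' \<longrightarrow>
        real (num_edges H') \<le> C * (d * real m powr \<alpha> / real n powr a)))"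
proof -
  define q where "q = k - 2"
  define s where "s = r - q"
  have k: "k = q + 2" and r: "r = s + q" and s: "0 < s"
    using assms by (auto simp: q_def s_def)
  define C where "C = real (r * s * r ^ (2 * q))"
  have "0 < C" using r s by (simp add: C_def)
  moreover have "ordered_rgraph r (run_hypergraph s q n)"
    "card (verts (run_hypergraph s q n)) = r * n" for n
    using ordered_rgraph_run_hypergraph[of s q n] by (simp_all add: r run_hypergraph_def)
  moreover have "1 \<le> num_edges (run_hypergraph s q n)" if "1 \<le> n" for n
    using that by (simp add: num_edges_run_hypergraph[OF s])
  moreover have "real (num_edges H') \<le> C * (d * real m powr \<alpha> / real n powr a)"
    if "1 \<le> n" "1 \<le> \<alpha>" "real (num_edges (run_hypergraph s q n)) = d * real n powr \<alpha>"
      "a = min 1 (real k - 1 - \<alpha>)" "ordered_rgraph r H'"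
      "subgraph H' (run_hypergraph s q n)" "interval_partite_size k m H'"
    for n m :: nat and \<alpha> d a :: real and H'
    using num_edges_interval_partite_run_subgraph_density_le[of s n \<alpha> q d H' m] that s
    by (simp add: C_def k r add.commute)
  ultimately show ?thesis
    by (intro exI[of _ "run_hypergraph s q"] exI[of _ C] conjI allI impI) blast+
qed

end
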